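(* Let $\mathbb K$ be a global field of characteristic $p>0$, let $G$ be a linear algebraic group over $\mathbb K$, and let $g\in G(\mathbb K)$. Let $q$ be any prime number. Suppose that for each $k\in\mathbb N$ there exists $x_k\in G(\mathbb K)$ such that $x_k^{q^k}=g$. Let $H$ be the Zariski-closure of the subgroup generated by $g$. Then: (i) for each $k\in\mathbb N$ there exists $y_k\in H(\mathbb K)$ such that $y_k^{q^k}=g$; (ii) if the order of $g$ is finite, then the order of $g$ is co-prime to $q$; (iii) if $g$ has $k$-th roots in $G(\mathbb K)$ for all $k\in\mathbb N$ (i.e. for every $k\in\mathbb N$ there is $h\in G(\mathbb K)$ with $h^k=g$), then $g=e$.
   Context: A global field is a finite extension of either $\mathbb Q$ or $\mathbb F_p(t)$; in characteristic $p>0$ it is a finite extension of $\mathbb F_p(t)$. Here $e$ denotes the identity element of $G$, and $H(\mathbb K)$ is the group of $\mathbb K$-points of the algebraic subgroup $H$ of $G$. *)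

theory Defs
  imports
    "HOL-Library.Poly_Mapping"
    "HOL-Computational_Algebra.Fraction_Field"
    "HOL-Algebra.Multiplicative_Group"
    "HOL-Algebra.Algebraic_Closure_Type"
    "Jordan_Normal_Form.Matrix"
    "Berlekamp_Zassenhaus.Finite_Field"
begin

text \<open>A homomorphism of fields making the codomain a finite-dimensional vector space over
  the domain.\<close>

definition finite_field_extension :: "('f::field \<Rightarrow> 'k::field) \<Rightarrow> bool" where
  "finite_field_extension \<phi> \<longleftrightarrow>
     field_hom \<phi> \<and> (\<exists>B. finite B \<and> module.span (\<lambda>c x. \<phi> c * x) B = UNIV)"

text \<open>For \<open>'p\<close> of prime cardinality p, the type \<open>'p mod_ring\<close> is the field with p elements
  and \<open>'p mod_ring poly fract\<close> is its field of rational functions in one variable.\<close>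

definition global_field_of_char :: "'p::prime_card itself \<Rightarrow> 'k::field itself \<Rightarrow> bool" where
  "global_field_of_char P K \<longleftrightarrow>
     (\<exists>\<phi> :: 'p mod_ring poly fract \<Rightarrow> 'k. finite_field_extension \<phi>)"

definition GL :: "nat \<Rightarrow> 'a::field mat monoid" where
  "GL n = units_of (ring_mat TYPE('a) n ())"

lemma group_GL: "group (GL n :: 'a::field mat monoid)"
proof -
  interpret ring "ring_mat TYPE('a) n ()" by (rule ring_mat)
  show ?thesis unfolding GL_def by (rule units_group)
qed

text \<open>Polynomials in indeterminates \<open>X(i,j)\<close>: a monomial maps \<open>(i,j)\<close> to the exponent of
  \<open>X(i,j)\<close>.\<close>

type_synonym 'a entry_poly = "(nat \<times> nat \<Rightarrow>\<^sub>0 nat) \<Rightarrow>\<^sub>0 'a"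

definition eval_entries :: "'a::field entry_poly \<Rightarrow> 'a mat \<Rightarrow> 'a" where
  "eval_entries f A =
     (\<Sum>m\<in>Poly_Mapping.keys f. Poly_Mapping.lookup f m *
       (\<Prod>ij\<in>Poly_Mapping.keys m. (A $$ ij) ^ Poly_Mapping.lookup m ij))"

definition entry_polys :: "nat \<Rightarrow> 'a::field set \<Rightarrow> 'a entry_poly set" where
  "entry_polys n C =
     {f. \<forall>m\<in>Poly_Mapping.keys f.
       Poly_Mapping.lookup f m \<in> C \<and> Poly_Mapping.keys m \<subseteq> {..<n} \<times> {..<n}}"

definition zero_locus :: "nat \<Rightarrow> 'a::field entry_poly set \<Rightarrow> 'a mat set" where
  "zero_locus n F = {A \<in> carrier (GL n). \<forall>f\<in>F. eval_entries f A = 0}"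

text \<open>The coordinate ring of \<open>GL n\<close> is the ring of polynomials in the entries with the
  determinant inverted. Clearing denominators does not change zero loci in \<open>GL n\<close>, so
  polynomials in the entries define all closed sets. The set \<open>C\<close> contains the
  admissible coefficients.\<close>

definition zariski_closed :: "nat \<Rightarrow> 'a::field set \<Rightarrow> 'a mat set \<Rightarrow> bool" where
  "zariski_closed n C Z \<longleftrightarrow> (\<exists>F \<subseteq> entry_polys n C. Z = zero_locus n F)"

definition zariski_closure :: "nat \<Rightarrow> 'a::field mat set \<Rightarrow> 'a mat set" where
  "zariski_closure n S = \<Inter>{Z. zariski_closed n UNIV Z \<and> S \<subseteq> Z}"

text \<open>A linear algebraic group over \<open>'k\<close> is given by its group of geometric points: a subgroup of
  \<open>GL n\<close> over the algebraic closure, cut out by polynomials with coefficients in \<open>'k\<close>.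
  The vanishing ideal is not required to be generated by polynomials over \<open>'k\<close>. Over an
  imperfect field this admits the geometric points of group schemes that are not smooth.\<close>

definition linear_algebraic_group :: "nat \<Rightarrow> 'k::field alg_closure mat set \<Rightarrow> bool" where
  "linear_algebraic_group n G \<longleftrightarrow> subgroup G (GL n) \<and> zariski_closed n (range to_ac) G"

definition rational_points :: "nat \<Rightarrow> 'k::field alg_closure mat set \<Rightarrow> 'k mat set" where
  "rational_points n G = {A \<in> carrier (GL n). map_mat to_ac A \<in> G}"

end

theory Submission
  imports Defs "Jordan_Normal_Form.Determinant"
begin

text \<open>
  Write \<open>R\<close> for the polynomial ring \<open>F\<^sub>p[t]\<close>, over whose fraction field the global
  field \<open>k\<close> is finite.
  The key facts concern invertible matrices over \<open>k\<close>: an element with \<open>q ^ k\<close>-th roots for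
  all \<open>k\<close> is torsion, and torsion elements have a common exponent \<open>M\<close>.

  Both are height arguments. A matrix \<open>x\<close> has a primitive minimal polynomial \<open>P\<close> in \<open>R[X]\<close>, of degree
  at most \<open>n\<^sup>2 [k : Frac R]\<close>, which by the lemma of Gauss divides in \<open>R[X]\<close> every polynomial that
  annihilates \<open>x\<close> (\<open>exists_primitive_minimal_polynomial\<close>). The degree in \<open>t\<close> of the
  coefficients plays the role of a height: it cannot decrease when passing to a nonzero multiple
  (\<open>coeff_degree_le_of_dvd\<close>), and only finitely many polynomials have bounded degrees in \<open>X\<close> and \<open>t\<close>.

  If \<open>x ^ m = g\<close> and \<open>F\<close> annihilates \<open>g\<close>, then \<open>F(X ^ m)\<close> annihilates \<open>x\<close> and has the same
  nonzero coefficients as \<open>F\<close>. So the minimal polynomials of all roots of \<open>g\<close> lie in one finite set.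
  For \<open>g = 1\<close> this yields the common exponent of torsion (\<open>torsion_exponent_bounded\<close>). For
  \<open>m = q ^ k\<close> with varying \<open>k\<close>, one polynomial \<open>P\<close> occurs infinitely often; the \<open>q ^ k\<close>-th powers of
  each root of \<open>P\<close> then recur among the roots of \<open>F\<close>, so the nonzero roots of \<open>P\<close> are roots of unity.
  In characteristic \<open>p\<close> a matrix whose eigenvalues are roots of unity has finite order, because
  a suitable \<open>p\<close>-power kills its unipotent part (\<open>torsion_if_prime_power_divisible\<close>).

  The rest is elementary group theory. All roots of \<open>g\<close> are torsion, hence killed by \<open>M\<close>; taking a
  \<open>q ^ k\<close>-th root with \<open>k\<close> larger than the exponent of \<open>q\<close> in \<open>M\<close> shows that the order of \<open>g\<close> is
  prime to \<open>q\<close>. Then \<open>g\<close> has \<open>q ^ k\<close>-th roots among its own powers, which lie in \<open>H\<close>. An \<open>M\<close>-th root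
  of \<open>g\<close>, if there is one, shows that \<open>g = 1\<close>.
\<close>

section \<open>Evaluation of polynomials at matrices\<close>

text \<open>A Horner scheme, because the type of all matrices is not a commutative monoid and has no
  finite sums: the zero matrix depends on the dimension.\<close>

definition poly_mat :: "'a::comm_ring_1 poly \<Rightarrow> 'a mat \<Rightarrow> 'a mat" where
  "poly_mat p x = fold_coeffs (\<lambda>a M. a \<cdot>\<^sub>m 1\<^sub>m (dim_row x) + M * x) p
     (0\<^sub>m (dim_row x) (dim_row x))"

lemma poly_mat_0 [simp]: "x \<in> carrier_mat n n \<Longrightarrow> poly_mat 0 x = 0\<^sub>m n n"
  by (auto simp: poly_mat_def)

lemma poly_mat_pCons:
  assumes "x \<in> carrier_mat n n"
  shows "poly_mat (pCons a p) x = a \<cdot>\<^sub>m 1\<^sub>m n + poly_mat p x * x"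
proof (cases "p = 0 \<and> a = 0")
  case True
  have "0 \<cdot>\<^sub>m 1\<^sub>m n + 0\<^sub>m n n * x = 0\<^sub>m n n"
    using assms by (intro eq_matI) auto
  with True assms show ?thesis by (simp add: poly_mat_def)
next
  case False
  with assms show ?thesis by (auto simp: poly_mat_def)
qed

lemma poly_mat_closed [simp]:
  "x \<in> carrier_mat n n \<Longrightarrow> poly_mat p x \<in> carrier_mat n n"
  by (induction p) (auto simp: poly_mat_pCons)

lemma poly_mat_mult_closed [simp]:
  "x \<in> carrier_mat n n \<Longrightarrow> poly_mat p x * x \<in> carrier_mat n n"
  using mult_carrier_mat[OF poly_mat_closed] by blast

lemma poly_mat_add:
  assumes x: "x \<in> carrier_mat n n"
  shows "poly_mat (p + q) x = poly_mat p x + poly_mat q x"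
proof (induction p q rule: poly_induct2)
  case (pCons a p b q)
  have [simp]: "poly_mat p x \<in> carrier_mat n n" "poly_mat q x \<in> carrier_mat n n"
    using x by auto
  have "(poly_mat p x + poly_mat q x) * x = poly_mat p x * x + poly_mat q x * x"
    using x by (intro add_mult_distrib_mat[of _ n n]) auto
  moreover have "(a + b) \<cdot>\<^sub>m 1\<^sub>m n + (A + B) = a \<cdot>\<^sub>m 1\<^sub>m n + A + (b \<cdot>\<^sub>m 1\<^sub>m n + B)"
    if "A \<in> carrier_mat n n" "B \<in> carrier_mat n n" for A B
    using that by (intro eq_matI) (auto simp: algebra_simps)
  ultimately show ?case
    using x pCons.IH by (simp add: poly_mat_pCons)
qed (use x in auto)

lemma poly_mat_smult:
  assumes x: "x \<in> carrier_mat n n"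
  shows "poly_mat (smult c p) x = c \<cdot>\<^sub>m poly_mat p x"
proof (induction p)
  case 0
  show ?case using x by auto
next
  case (pCons a p)
  have [simp]: "poly_mat p x \<in> carrier_mat n n"
    using x by auto
  have "(c * a) \<cdot>\<^sub>m 1\<^sub>m n + c \<cdot>\<^sub>m A = c \<cdot>\<^sub>m (a \<cdot>\<^sub>m 1\<^sub>m n + A)"
    if "A \<in> carrier_mat n n" for A
    using that by (intro eq_matI) (auto simp: algebra_simps)
  then show ?case
    using x pCons.IH by (simp add: poly_mat_pCons mult_smult_assoc_mat[of _ n n x n])
qed

lemma poly_mat_monom_mult:
  assumes x: "x \<in> carrier_mat n n"
  shows "poly_mat (monom 1 m * p) x = poly_mat p x * x ^\<^sub>m m"
proof (induction m)
  case 0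
  have "poly_mat p x * 1\<^sub>m n = poly_mat p x" using x by (intro right_mult_one_mat[of _ n n]) auto
  then show ?case using x by simp
next
  case (Suc m)
  have "monom 1 (Suc m) * p = pCons 0 (monom 1 m * p)"
    by (simp add: monom_Suc)
  moreover have "0 \<cdot>\<^sub>m 1\<^sub>m n + A = A" if "A \<in> carrier_mat n n" for A :: "'a mat"
    using that by (intro eq_matI) auto
  moreover have "poly_mat p x * x ^\<^sub>m m * x = poly_mat p x * (x ^\<^sub>m m * x)"
    using x by (intro assoc_mult_mat[of _ n n _ n]) auto
  moreover have "poly_mat p x * (x ^\<^sub>m m * x) \<in> carrier_mat n n"
    using x by (intro mult_carrier_mat[of _ n n] pow_carrier_mat) auto
  ultimately show ?case using x Suc by (simp add: poly_mat_pCons)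
qed

lemma poly_mat_1 [simp]: "x \<in> carrier_mat n n \<Longrightarrow> poly_mat 1 x = 1\<^sub>m n"
  unfolding one_pCons by (simp add: poly_mat_pCons) (intro eq_matI; auto)

lemma poly_mat_monom: "x \<in> carrier_mat n n \<Longrightarrow> poly_mat (monom 1 m) x = x ^\<^sub>m m"
  using poly_mat_monom_mult[of x n m 1] by auto

lemma poly_mat_mult_eq_0:
  assumes x: "x \<in> carrier_mat n n" and p: "poly_mat p x = 0\<^sub>m n n"
  shows "poly_mat (q * p) x = 0\<^sub>m n n"
proof (induction q)
  case 0
  show ?case using x by simp
next
  case (pCons a q)
  have "a \<cdot>\<^sub>m 0\<^sub>m n n + (0 \<cdot>\<^sub>m 1\<^sub>m n + 0\<^sub>m n n * x) = 0\<^sub>m n n"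
    using x by (intro eq_matI) auto
  then show ?case
    using x p pCons by (simp add: poly_mat_add poly_mat_smult poly_mat_pCons)
qed

lemma pow_mat_mult:
  fixes x :: "'a::comm_ring_1 mat"
  assumes x: "x \<in> carrier_mat n n"
  shows "x ^\<^sub>m (m * k) = (x ^\<^sub>m m) ^\<^sub>m k"
proof -
  interpret ring "ring_mat TYPE('a) n ()" by (rule ring_mat)
  have "(x ^\<^sub>m m) ^\<^sub>m k = (x ^\<^sub>m m) [^]\<^bsub>ring_mat TYPE('a) n ()\<^esub> k"
    using x by (intro pow_mat_ring_pow) auto
  then show ?thesis
    using x nat_pow_pow[of x m k] by (simp add: pow_mat_ring_pow[of _ n _ "()"] ring_mat_simps)
qed

lemma poly_mat_pcompose_monom:
  assumes x: "x \<in> carrier_mat n n"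
  shows "poly_mat (p \<circ>\<^sub>p monom 1 m) x = poly_mat p (x ^\<^sub>m m)"
proof (induction p)
  case 0
  show ?case by (simp only: pcompose_0 poly_mat_0[OF x] poly_mat_0[OF pow_carrier_mat[OF x]])
next
  case (pCons a p)
  have y: "x ^\<^sub>m m \<in> carrier_mat n n" using x by auto
  have "poly_mat [:a:] x = a \<cdot>\<^sub>m 1\<^sub>m n"
    using x by (simp add: poly_mat_pCons)
  then show ?case
    using x pCons.IH
    by (simp add: pcompose_pCons poly_mat_add poly_mat_monom_mult poly_mat_pCons[OF y])
qed

text \<open>The entries of \<open>p(x)\<close> are linear in the coefficients of \<open>p\<close>; this turns the search for an
  annihilating polynomial into a system of linear equations. The bound \<open>N\<close> is free so that
  all candidates of bounded degree lead to the same system.\<close>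

lemma poly_mat_index:
  assumes x: "x \<in> carrier_mat n n" and "degree p < N" and "i < n" "j < n"
  shows "poly_mat p x $$ (i, j) = (\<Sum>k<N. coeff p k * (x ^\<^sub>m k) $$ (i, j))"
  using assms(2-)
proof (induction p arbitrary: N j)
  case 0
  then show ?case using x by simp
next
  case (pCons a p)
  have px: "poly_mat p x \<in> carrier_mat n n" using x by auto
  obtain N' where N: "N = Suc N'" using pCons.prems by (cases N) auto
  have deg: "p \<noteq> 0 \<Longrightarrow> degree p < N'"
    using pCons.prems N by (simp split: if_splits)
  have IH: "poly_mat p x $$ (i, l) = (\<Sum>k<N'. coeff p k * (x ^\<^sub>m k) $$ (i, l))" if "l < n" for l
  proof (cases "p = 0")
    case False
    with deg pCons.IH pCons.prems that show ?thesis by blast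
  qed (use x pCons.prems that in simp)
  have pow: "(x ^\<^sub>m Suc k) $$ (i, j) = (\<Sum>l<n. (x ^\<^sub>m k) $$ (i, l) * x $$ (l, j))" for k
    using x pCons.prems pow_carrier_mat[OF x, of k]
    by (auto simp: scalar_prod_def atLeast0LessThan intro!: sum.cong)
  have "(poly_mat p x * x) $$ (i, j) = (\<Sum>l<n. poly_mat p x $$ (i, l) * x $$ (l, j))"
    using x carrier_matD[OF px] pCons.prems
    by (auto simp: scalar_prod_def atLeast0LessThan intro!: sum.cong)
  also have "\<dots> = (\<Sum>l<n. \<Sum>k<N'. coeff p k * ((x ^\<^sub>m k) $$ (i, l) * x $$ (l, j)))"
    by (simp add: IH sum_distrib_right mult.assoc)
  also have "\<dots> = (\<Sum>k<N'. coeff p k * (x ^\<^sub>m Suc k) $$ (i, j))"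
    unfolding pow by (subst sum.swap) (simp add: sum_distrib_left)
  finally have "(poly_mat p x * x) $$ (i, j) = (\<Sum>k<N'. coeff p k * (x ^\<^sub>m Suc k) $$ (i, j))" .
  then show ?case
    using x pCons.prems carrier_matD[OF poly_mat_mult_closed[OF x, of p]]
    unfolding N sum.lessThan_Suc_shift poly_mat_pCons[OF x]
    by (simp del: pow_mat.simps(2) index_mult_mat(1))
qed

section \<open>Polynomials with polynomial coefficients\<close>

text \<open>The largest degree in \<open>t\<close> of the coefficients of an element of \<open>A[t][X]\<close> is its degree as a
  polynomial in \<open>t\<close> over \<open>A[X]\<close>. It is therefore additive under products of nonzero polynomials
  when \<open>A\<close> is a domain, so a divisor of a nonzero polynomial cannot exceed it.\<close>

lemma coeff_degree_le_of_dvd: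
  fixes P F :: "'a::idom poly poly"
  assumes "P dvd F" "F \<noteq> 0" and C: "\<And>i. degree (coeff F i) \<le> C"
  shows "degree (coeff P i) \<le> C"
proof -
  from assms obtain Q where F: "F = P * Q" and nz: "P \<noteq> 0" "Q \<noteq> 0" by auto
  \<comment> \<open>A bidegree \<open>(i, a)\<close> of \<open>R\<close> that is maximal when the degree \<open>a\<close> in \<open>t\<close> is compared first.\<close>
  have top: "\<exists>a i. coeff (coeff R i) a \<noteq> 0 \<and> (\<forall>u. degree (coeff R u) \<le> a) \<and>
      (\<forall>u>i. coeff (coeff R u) a = 0)" if "R \<noteq> 0" for R :: "'a poly poly"
  proof -
    define a where "a = Max ((\<lambda>u. degree (coeff R u)) ` {..degree R})"
    define I where "I = {u. coeff (coeff R u) a \<noteq> 0}"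
    have le: "degree (coeff R u) \<le> a" for u
      by (cases "u \<le> degree R") (auto simp: a_def coeff_eq_0 not_le)
    have "a \<in> (\<lambda>u. degree (coeff R u)) ` {..degree R}" unfolding a_def by (intro Max_in) auto
    then obtain u where u: "a = degree (coeff R u)" by auto
    have "\<exists>u. coeff (coeff R u) a \<noteq> 0"
    proof (cases "coeff R u = 0")
      case True
      then have "a = 0" using u by simp
      with le have "degree (lead_coeff R) = 0" by (metis le_zero_eq)
      with that \<open>a = 0\<close> show ?thesis by (metis leading_coeff_0_iff)
    next
      case False
      with u show ?thesis by (metis leading_coeff_0_iff)
    qed
    then have "I \<noteq> {}" by (auto simp: I_def)
    moreover have "I \<subseteq> {..degree R}" by (auto simp: I_def intro!: le_degree)
    then have "finite I" by (rule finite_subset) simp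
    ultimately have "Max I \<in> I" and "\<And>u. u > Max I \<Longrightarrow> u \<notin> I"
      by (auto dest: Max_ge)
    then have "coeff (coeff R (Max I)) a \<noteq> 0" "\<forall>u>Max I. coeff (coeff R u) a = 0"
      unfolding I_def by blast+
    with le show ?thesis by blast
  qed
  obtain a k where P: "coeff (coeff P k) a \<noteq> 0" "\<And>u. degree (coeff P u) \<le> a"
      "\<And>u. u > k \<Longrightarrow> coeff (coeff P u) a = 0" using top[OF nz(1)] by blast
  obtain b j where Q: "coeff (coeff Q j) b \<noteq> 0" "\<And>u. degree (coeff Q u) \<le> b"
      "\<And>u. u > j \<Longrightarrow> coeff (coeff Q u) b = 0" using top[OF nz(2)] by blast
  have prod: "coeff (p * q) (a + b) = coeff p a * coeff q b"
    if "degree p \<le> a" "degree q \<le> b" for p q :: "'a poly"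
  proof -
    have "coeff (p * q) (a + b) = (\<Sum>u\<in>{a}. coeff p u * coeff q (a + b - u))"
      unfolding coeff_mult using that
      by (intro sum.mono_neutral_right) (auto simp: not_le coeff_eq_0 neq_iff)
    then show ?thesis by simp
  qed
  \<comment> \<open>The leading coefficients for this order multiply, so they cannot cancel in the product.\<close>
  have "coeff (coeff F (k + j)) (a + b) =
      (\<Sum>u\<le>k + j. coeff (coeff P u) a * coeff (coeff Q (k + j - u)) b)"
    unfolding F coeff_mult[of P Q] coeff_sum using P(2) Q(2) by (intro sum.cong refl prod)
  also have "\<dots> = (\<Sum>u\<in>{k}. coeff (coeff P u) a * coeff (coeff Q (k + j - u)) b)"
    using P(3) Q(3) by (intro sum.mono_neutral_right) (auto simp: neq_iff)
  also have "\<dots> \<noteq> 0" using P Q by simp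
  finally have "a + b \<le> degree (coeff F (k + j))" by (rule le_degree)
  with C[of "k + j"] P(2)[of i] show ?thesis by linarith
qed

lemma finite_polys_bounded:
  fixes A :: "'a::zero set"
  assumes "finite A"
  shows "finite {p. degree p \<le> D \<and> (\<forall>i. coeff p i \<in> A)}"
proof (rule finite_subset)
  show "finite (Poly ` {xs. set xs \<subseteq> A \<and> length xs \<le> Suc D})"
    using assms by (intro finite_imageI finite_lists_length_le)
  show "{p. degree p \<le> D \<and> (\<forall>i. coeff p i \<in> A)} \<subseteq> Poly ` {xs. set xs \<subseteq> A \<and> length xs \<le> Suc D}"
  proof
    fix p assume p: "p \<in> {p. degree p \<le> D \<and> (\<forall>i. coeff p i \<in> A)}"
    have "length (coeffs p) \<le> Suc D" using p by (cases "p = 0") (auto simp: length_coeffs_degree)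
    moreover have "set (coeffs p) \<subseteq> A"
      using p by (auto simp: coeffs_def split: if_splits)
    ultimately show "p \<in> Poly ` {xs. set xs \<subseteq> A \<and> length xs \<le> Suc D}"
      by (intro image_eqI[of _ _ "coeffs p"]) auto
  qed
qed

lemma degree_coeff_pcompose_monom_le:
  fixes F :: "'a::comm_ring_1 poly poly"
  assumes "\<And>i. degree (coeff F i) \<le> C"
  shows "degree (coeff (F \<circ>\<^sub>p monom 1 m) i) \<le> C"
  using assms
proof (induction F arbitrary: i)
  case (pCons a F)
  have "degree (coeff F i) \<le> C" for i
    using pCons.prems[of "Suc i"] by simp
  with pCons.IH have "degree (coeff (F \<circ>\<^sub>p monom 1 m) i) \<le> C" for i by blast
  moreover have "degree a \<le> C" using pCons.prems[of 0] by simp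
  ultimately show ?case
    by (auto simp: pcompose_pCons coeff_monom_mult coeff_pCons simp del: coeff_pcompose_0
      intro!: degree_add_le split: nat.splits)
qed simp

lemma finite_poly_polys_bounded:
  "finite {P :: 'a::{finite,zero} poly poly. degree P \<le> D \<and> (\<forall>i. degree (coeff P i) \<le> C)}"
proof -
  have "finite {c :: 'a poly. degree c \<le> C}"
    using finite_polys_bounded[of "UNIV :: 'a set" C] by simp
  from finite_polys_bounded[OF this, of D] show ?thesis by simp
qed

section \<open>Minimal polynomials over the base ring\<close>

text \<open>Coefficients are mapped along \<open>\<psi>\<close>, so that one matrix over \<open>k\<close> can be tested against polynomials
  over the rational function field as well as over its subring of polynomials.\<close>

definition annihilates :: "('r::comm_ring_1 \<Rightarrow> 'k::comm_ring_1) \<Rightarrow> 'r poly \<Rightarrow> 'k mat \<Rightarrow> bool" where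
  "annihilates \<psi> F x \<longleftrightarrow> poly_mat (map_poly \<psi> F) x = 0\<^sub>m (dim_row x) (dim_row x)"

context comm_ring_hom
begin

interpretation map_poly_hom: map_poly_comm_ring_hom ..

lemma annihilates_mult:
  assumes "x \<in> carrier_mat n n" "annihilates hom F x"
  shows "annihilates hom (Q * F) x"
  using assms poly_mat_mult_eq_0[of x n "map_poly hom F" "map_poly hom Q"]
  by (auto simp: annihilates_def hom_distribs)

lemma annihilates_add:
  assumes "x \<in> carrier_mat n n" "annihilates hom F x" "annihilates hom Q x"
  shows "annihilates hom (F + Q) x"
  using assms by (auto simp: annihilates_def hom_distribs poly_mat_add)

lemma annihilates_pcompose_monom:
  assumes "x \<in> carrier_mat n n"
  shows "annihilates hom (F \<circ>\<^sub>p monom 1 m) x \<longleftrightarrow> annihilates hom F (x ^\<^sub>m m)"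
  using assms by (auto simp: annihilates_def hom_distribs poly_mat_pcompose_monom)

lemma annihilates_monom_minus_1:
  assumes x: "x \<in> carrier_mat n n"
  shows "annihilates hom (monom 1 m - 1) x \<longleftrightarrow> x ^\<^sub>m m = 1\<^sub>m n"
proof -
  have "poly_mat (map_poly hom (monom 1 m - 1)) x + 1\<^sub>m n = x ^\<^sub>m m"
    using poly_mat_add[OF x, of "monom 1 m - 1" 1] x by (simp add: hom_distribs poly_mat_monom)
  moreover have "A = 0\<^sub>m n n \<longleftrightarrow> A + 1\<^sub>m n = 1\<^sub>m n" if A: "A \<in> carrier_mat n n" for A :: "'b mat"
  proof
    assume *: "A + 1\<^sub>m n = 1\<^sub>m n"
    show "A = 0\<^sub>m n n"
    proof (rule eq_matI)
      fix i j assume "i < dim_row (0\<^sub>m n n :: 'b mat)" "j < dim_col (0\<^sub>m n n :: 'b mat)"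
      with A arg_cong[OF *, of "\<lambda>M. M $$ (i, j)"] show "A $$ (i, j) = 0\<^sub>m n n $$ (i, j)" by simp
    qed (use A in auto)
  qed auto
  ultimately show ?thesis
    using x poly_mat_closed[OF x] by (auto simp: annihilates_def)
qed

lemma annihilates_monom_mult_cancel:
  assumes x: "x \<in> carrier_mat n n" and y: "y \<in> carrier_mat n n" "x * y = 1\<^sub>m n"
    and "annihilates hom (monom 1 s * F) x"
  shows "annihilates hom F x"
  using assms(4)
proof (induction s)
  case (Suc s)
  let ?A = "poly_mat (map_poly hom (monom 1 s * F)) x"
  have A: "?A \<in> carrier_mat n n" using x by simp
  have "poly_mat (monom 1 1 * map_poly hom (monom 1 s * F)) x = ?A * x ^\<^sub>m 1"
    by (rule poly_mat_monom_mult[OF x])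
  moreover have "monom 1 1 * map_poly hom (monom 1 s * F) = map_poly hom (monom 1 (Suc s) * F)"
    by (simp add: hom_distribs mult_monom flip: mult.assoc)
  ultimately have "?A * x = 0\<^sub>m n n" using Suc.prems x by (auto simp: annihilates_def)
  then have "?A * x * y = 0\<^sub>m n n" using y by simp
  then have "?A = 0\<^sub>m n n" using x y A by (simp add: assoc_mult_mat[OF A x y(1)])
  then show ?case using Suc.IH x by (simp add: annihilates_def)
qed simp

end

text \<open>Padding the system with zero equations makes it square with determinant zero, so it has a
  nontrivial kernel.\<close>

lemma homogeneous_system_nontrivial_solution:
  fixes r :: "nat \<Rightarrow> 'e \<Rightarrow> 'f::field"
  assumes "finite E" and "card E < N"
  shows "\<exists>c. (\<exists>i<N. c i \<noteq> 0) \<and> (\<forall>e\<in>E. (\<Sum>i<N. c i * r i e) = 0)"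
proof -
  obtain f where f: "bij_betw f {..<card E} E"
    using ex_bij_betw_nat_finite[OF assms(1)] by (auto simp: atLeast0LessThan)
  define A where "A = mat N N (\<lambda>(u, i). if u < card E then r i (f u) else 0)"
  have A: "A \<in> carrier_mat N N" by (simp add: A_def)
  have "det A = 0"
    using laplace_expansion_row[OF A assms(2)] assms(2) by (simp add: A_def)
  then obtain v where v: "v \<in> carrier_vec N" "v \<noteq> 0\<^sub>v N" "A *\<^sub>v v = 0\<^sub>v N"
    using det_0_iff_vec_prod_zero[OF A] by blast
  show ?thesis
  proof (intro exI[of _ "\<lambda>i. v $ i"] conjI ballI)
    show "\<exists>i<N. v $ i \<noteq> 0" using v by (metis carrier_vecD eq_vecI index_zero_vec)
    fix e assume "e \<in> E"
    then obtain u where u: "u < card E" "e = f u" using f by (auto simp: bij_betw_def)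
    have "(\<Sum>i<N. r i e * v $ i) = (A *\<^sub>v v) $ u"
      using v(1) u assms by (auto simp: A_def scalar_prod_def atLeast0LessThan intro!: sum.cong)
    also have "\<dots> = 0" using v(3) u assms by simp
    finally show "(\<Sum>i<N. v $ i * r i e) = 0" by (simp add: mult.commute)
  qed
qed

text \<open>If \<open>k\<close> is spanned by \<open>d\<close> elements over the base field, the \<open>n \<times> n\<close> matrices over \<open>k\<close> have dimension
  at most \<open>n\<^sup>2 d\<close>, so the powers of \<open>x\<close> up to that exponent are linearly dependent over the base field.
  The bound on the degree is the same for all \<open>x\<close>.\<close>

lemma exists_annihilator_bounded_degree:
  fixes \<phi> :: "'f::field \<Rightarrow> 'k::field"
  assumes "finite_field_extension \<phi>"
  obtains D where "\<And>x. x \<in> carrier_mat n n \<Longrightarrow> \<exists>p. p \<noteq> 0 \<and> degree p \<le> D \<and> annihilates \<phi> p x"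
proof -
  from assms obtain B where hom: "field_hom \<phi>" and B: "finite B"
      "module.span (\<lambda>c x. \<phi> c * x) B = UNIV"
    by (auto simp: finite_field_extension_def)
  interpret field_hom \<phi> by (rule hom)
  interpret Modules.module "\<lambda>c x. \<phi> c * x"
    by unfold_locales (simp_all add: hom_add hom_mult ring_distribs mult.assoc)
  have "y \<in> range (\<lambda>u. \<Sum>b\<in>B. \<phi> (u b) * b)" for y
    unfolding span_finite[OF B(1), symmetric] B(2) by (rule UNIV_I)
  then have "\<exists>u. (\<Sum>b\<in>B. \<phi> (u b) * b) = y" for y by (auto simp: image_iff dest: sym)
  then obtain u where u: "(\<Sum>b\<in>B. \<phi> (u y b) * b) = y" for y by metis
  define E where "E = {..<n} \<times> {..<n} \<times> B"
  have "finite E" using B by (simp add: E_def)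
  show thesis
  proof (rule that[of "card E"])
    fix x :: "'k mat" assume x: "x \<in> carrier_mat n n"
    \<comment> \<open>\<open>r k (i, j, b)\<close> is the coordinate along \<open>b\<close> of the \<open>(i, j)\<close> entry of \<open>x ^ k\<close>.\<close>
    define r where "r k = (\<lambda>(i, j, b). u ((x ^\<^sub>m k) $$ (i, j)) b)" for k
    from homogeneous_system_nontrivial_solution[OF \<open>finite E\<close> lessI, of r] obtain c k0
      where k0: "k0 < Suc (card E)" "c k0 \<noteq> 0"
        and c: "\<And>e. e \<in> E \<Longrightarrow> (\<Sum>k<Suc (card E). c k * r k e) = 0" by blast
    define p where "p = Poly (map c [0..<Suc (card E)])"
    have coeff: "coeff p k = (if k < Suc (card E) then c k else 0)" for k
      by (simp add: p_def nth_default_def del: upt_Suc)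
    have deg: "degree p \<le> card E" by (rule degree_le) (simp add: coeff)
    have "poly_mat (map_poly \<phi> p) x = 0\<^sub>m n n"
    proof (rule eq_matI)
      fix i j assume "i < dim_row (0\<^sub>m n n :: 'k mat)" "j < dim_col (0\<^sub>m n n :: 'k mat)"
      then have ij: "i < n" "j < n" by simp_all
      have entry: "(x ^\<^sub>m k) $$ (i, j) = (\<Sum>b\<in>B. \<phi> (r k (i, j, b)) * b)" for k
        by (simp add: r_def u)
      have equations: "(\<Sum>k<Suc (card E). c k * r k (i, j, b)) = 0" if "b \<in> B" for b
        by (rule c) (use that ij in \<open>simp add: E_def\<close>)
      have "poly_mat (map_poly \<phi> p) x $$ (i, j) =
          (\<Sum>k<Suc (card E). \<phi> (c k) * (x ^\<^sub>m k) $$ (i, j))"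
        using poly_mat_index[OF x _ ij, of "map_poly \<phi> p" "Suc (card E)"] deg
        by (simp add: coeff_map_poly coeff less_Suc_eq_le del: sum.lessThan_Suc)
      also have "\<dots> = (\<Sum>k<Suc (card E). \<Sum>b\<in>B. \<phi> (c k * r k (i, j, b)) * b)"
        by (simp only: entry hom_mult sum_distrib_left mult.assoc)
      also have "\<dots> = (\<Sum>b\<in>B. \<phi> (\<Sum>k<Suc (card E). c k * r k (i, j, b)) * b)"
        by (subst sum.swap) (simp only: hom_sum sum_distrib_right)
      also have "\<dots> = 0"
        by (intro sum.neutral ballI) (simp only: equations hom_zero mult_zero_left)
      finally show "poly_mat (map_poly \<phi> p) x $$ (i, j) = 0\<^sub>m n n $$ (i, j)" using ij by simp
    qed (use carrier_matD[OF poly_mat_closed[OF x, of "map_poly \<phi> p"]] in auto)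
    moreover have "p \<noteq> 0" using k0 coeff by (metis coeff_0)
    ultimately show "\<exists>p. p \<noteq> 0 \<and> degree p \<le> card E \<and> annihilates \<phi> p x"
      using deg x by (auto simp: annihilates_def)
  qed
qed

text \<open>The minimal polynomial of \<open>x\<close> over the fraction field, scaled to a primitive polynomial \<open>P\<close>
  over the factorial ring. By the lemma of Gauss, \<open>P\<close> generates the ideal of all polynomials over
  the ring itself, not just over its fraction field, that annihilate \<open>x\<close>. This makes divisibility
  by \<open>P\<close> strong enough to bound the degrees in \<open>t\<close> of its coefficients.\<close>

lemma exists_primitive_minimal_polynomial:
  fixes \<phi> :: "'r::{factorial_semiring,semiring_Gcd,ring_gcd,idom_divide,
      semiring_gcd_mult_normalize} fract \<Rightarrow> 'k::field"
  assumes "finite_field_extension \<phi>"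
  obtains D where "\<And>x. x \<in> carrier_mat n n \<Longrightarrow> \<exists>P. P \<noteq> 0 \<and> degree P \<le> D \<and> content P = 1 \<and>
    (\<forall>F. annihilates (\<phi> \<circ> to_fract) F x \<longleftrightarrow> P dvd F)"
proof -
  interpret field_hom \<phi> using assms by (simp add: finite_field_extension_def)
  obtain D where D: "\<And>x. x \<in> carrier_mat n n \<Longrightarrow> \<exists>p. p \<noteq> 0 \<and> degree p \<le> D \<and> annihilates \<phi> p x"
    using exists_annihilator_bounded_degree[OF assms] by blast
  show thesis
  proof (rule that[of D])
    fix x :: "'k mat" assume x: "x \<in> carrier_mat n n"
    obtain p where p: "p \<noteq> 0" "annihilates \<phi> p x"
      and min: "\<And>f. f \<noteq> 0 \<Longrightarrow> annihilates \<phi> f x \<Longrightarrow> degree p \<le> degree f"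
      using ex_has_least_nat[of "\<lambda>p. p \<noteq> 0 \<and> annihilates \<phi> p x" _ degree] D[OF x] by blast
    have iff: "annihilates \<phi> f x \<longleftrightarrow> p dvd f" for f
    proof
      assume f: "annihilates \<phi> f x"
      have "annihilates \<phi> (f + (- (f div p)) * p) x"
        using x f p annihilates_mult annihilates_add by blast
      then have "annihilates \<phi> (f mod p) x" by (simp add: minus_div_mult_eq_mod[symmetric])
      then have "f mod p = 0"
        using min degree_mod_less[OF p(1), of f] linorder_not_le by blast
      then show "p dvd f" by auto
    qed (use x p annihilates_mult in \<open>auto simp: mult.commute elim!: dvdE\<close>)
    define P where "P = primitive_part_fract p"
    have content: "content P = 1" using p by (simp add: P_def)
    have "p = smult (fract_content p) (fract_poly P)"
      by (simp add: P_def content_times_primitive_part_fract)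
    then have dvd: "p dvd f \<longleftrightarrow> fract_poly P dvd f" for f
      using p(1) by (metis fract_content_eq_0_iff smult_dvd_iff)
    have "annihilates (\<phi> \<circ> to_fract) F x \<longleftrightarrow> annihilates \<phi> (fract_poly F) x" for F
      by (simp add: annihilates_def map_poly_map_poly)
    then have "annihilates (\<phi> \<circ> to_fract) F x \<longleftrightarrow> P dvd F" for F
      using fract_poly_dvdD[OF _ content] by (auto simp: iff dvd)
    moreover have "P \<noteq> 0" using content by auto
    moreover have "degree P \<le> D" using D[OF x] min by (auto simp: P_def intro: order_trans)
    ultimately show "\<exists>P. P \<noteq> 0 \<and> degree P \<le> D \<and> content P = 1 \<and>
        (\<forall>F. annihilates (\<phi> \<circ> to_fract) F x \<longleftrightarrow> P dvd F)" using content by blast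
  qed
qed

section \<open>Recurring powers of roots\<close>

text \<open>Over an algebraically closed field a polynomial is a product of \<open>degree p\<close> linear factors, and
  each of them divides \<open>w\<close>.\<close>

lemma dvd_power_if_roots:
  fixes p w :: "'a::alg_closed_field poly"
  assumes "p \<noteq> 0" and "\<And>z. poly p z = 0 \<Longrightarrow> poly w z = 0"
  shows "p dvd w ^ degree p"
proof -
  obtain A where A: "size A = degree p" "p = smult (lead_coeff p) (\<Prod>z\<in>#A. [:-z, 1:])"
    using alg_closed_imp_factorization[OF assms(1)] by blast
  have "poly p z = 0" if "z \<in># A" for z
    using that by (subst A(2)) (auto simp: poly_prod_mset)
  then have "\<forall>z\<in>#A. [:-z, 1:] dvd w"
    using assms(2) by (auto simp: poly_eq_0_iff_dvd)
  then have "(\<Prod>z\<in>#A. [:-z, 1:]) dvd w ^ size A"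
    by (induction A) (auto intro!: mult_dvd_mono simp del: mult_pCons_left)
  with A show ?thesis
    by (metis assms(1) leading_coeff_0_iff smult_dvd_iff)
qed

text \<open>A root \<open>z\<close> of \<open>P\<close> in an algebraic closure makes every \<open>z ^ (q ^ l)\<close> with \<open>l \<in> \<Lambda>\<close> a root of the
  single polynomial \<open>F\<close>. There are only finitely many such roots, so two of these powers agree and
  \<open>z\<close> is zero or a root of unity. Hence \<open>P\<close> divides a power of \<open>X (X ^ M - 1)\<close>. In positive
  characteristic the exponent can be taken to be a power of the characteristic, which turns the
  power of \<open>X ^ M - 1\<close> into a polynomial of the same shape.\<close>

lemma dvd_monom_times_unity_if_roots_recur:
  fixes P F :: "'r::{factorial_semiring,semiring_Gcd,ring_gcd,idom_divide,
      semiring_gcd_mult_normalize} poly"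
  assumes char: "prime CHAR('r)"
    and P: "content P = 1" and "F \<noteq> 0"
    and "q \<ge> 2" and \<Lambda>: "infinite \<Lambda>" "\<And>l. l \<in> \<Lambda> \<Longrightarrow> P dvd F \<circ>\<^sub>p monom 1 (q ^ l)"
  shows "\<exists>s M. M > 0 \<and> P dvd monom 1 s * (monom 1 M - 1)"
proof -
  define \<kappa> :: "'r \<Rightarrow> 'r fract alg_closure" where "\<kappa> = to_ac \<circ> to_fract"
  interpret \<kappa>: inj_idom_hom \<kappa> by unfold_locales (auto simp: \<kappa>_def)
  interpret to_ac: field_hom "to_ac :: 'r fract \<Rightarrow> _" by unfold_locales auto
  interpret map_poly_\<kappa>: map_poly_inj_idom_hom \<kappa> ..
  have "P \<noteq> 0" using P by auto
  define Z where "Z = {z. poly (map_poly \<kappa> P) z = 0}"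
  have "finite Z" using \<open>P \<noteq> 0\<close> by (auto simp: Z_def intro!: poly_roots_finite)
  have "\<exists>m>0. z = 0 \<or> z ^ m = 1" if "z \<in> Z" for z
  proof -
    have "poly (map_poly \<kappa> F) (z ^ (q ^ l)) = 0" if "l \<in> \<Lambda>" for l
    proof -
      from \<Lambda>(2)[OF that] obtain Q where "F \<circ>\<^sub>p monom 1 (q ^ l) = P * Q" by blast
      then have "map_poly \<kappa> F \<circ>\<^sub>p monom 1 (q ^ l) = map_poly \<kappa> P * map_poly \<kappa> Q"
        by (metis \<kappa>.map_poly_pcompose map_poly_\<kappa>.hom_mult map_poly_monom \<kappa>.hom_zero \<kappa>.hom_one)
      from arg_cong[OF this, of "\<lambda>p. poly p z"] \<open>z \<in> Z\<close> show ?thesis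
        by (simp add: poly_pcompose poly_monom Z_def)
    qed
    then have "finite ((\<lambda>l. z ^ (q ^ l)) ` \<Lambda>)"
      using \<open>F \<noteq> 0\<close> by (intro finite_subset[OF _ poly_roots_finite[of "map_poly \<kappa> F"]]) auto
    then have "\<not> inj_on (\<lambda>l. z ^ (q ^ l)) \<Lambda>" using \<Lambda>(1) finite_imageD by blast
    then obtain k l where kl: "k < l" "z ^ (q ^ k) = z ^ (q ^ l)"
      unfolding inj_on_def by (metis linorder_neqE_nat)
    define m where "m = q ^ l - q ^ k"
    have "q ^ k < q ^ l" using kl \<open>q \<ge> 2\<close> by (intro power_strict_increasing) auto
    then have "m > 0" and l: "q ^ l = q ^ k + m" by (auto simp: m_def)
    have "z ^ (q ^ k) * (z ^ m - 1) = 0" using kl unfolding l by (simp add: power_add algebra_simps)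
    with \<open>m > 0\<close> show ?thesis by auto
  qed
  then obtain m where m: "\<And>z. z \<in> Z \<Longrightarrow> m z > (0::nat) \<and> (z = 0 \<or> z ^ m z = 1)" by metis
  define M where "M = (\<Prod>z\<in>Z. m z)"
  have "M > 0" using m by (auto simp: M_def intro!: prod_pos)
  \<comment> \<open>The factor \<open>X\<close> accounts for the root zero.\<close>
  define w :: "'r poly" where "w = monom 1 1 * (monom 1 M - 1)"
  have w: "map_poly \<kappa> w = monom 1 1 * (monom 1 M - 1)"
    by (simp add: w_def map_poly_\<kappa>.hom_mult map_poly_\<kappa>.hom_minus map_poly_monom)
  have "map_poly \<kappa> P dvd map_poly \<kappa> w ^ degree (map_poly \<kappa> P)"
  proof (rule dvd_power_if_roots)
    fix z assume "poly (map_poly \<kappa> P) z = 0"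
    then have z: "z \<in> Z" by (simp add: Z_def)
    have "m z dvd M" unfolding M_def using z \<open>finite Z\<close> by (rule dvd_prodI[rotated])
    then obtain c where "M = m z * c" by blast
    with m[OF z] have "z = 0 \<or> z ^ M = 1" by (auto simp: power_mult)
    then show "poly (map_poly \<kappa> w) z = 0" by (auto simp: w poly_monom)
  qed (use \<open>P \<noteq> 0\<close> in simp)
  then have "map_poly to_ac (fract_poly P) dvd map_poly to_ac (fract_poly (w ^ degree P))"
    by (simp add: map_poly_map_poly \<kappa>_def[symmetric] map_poly_\<kappa>.hom_power)
  then have "P dvd w ^ degree P"
    using fract_poly_dvdD[OF _ P] to_ac.dvd_map_poly_hom_imp_dvd by blast
  moreover define e where "e = CHAR('r) ^ degree P"
  have "degree P \<le> e" using prime_gt_1_nat[OF char] by (simp add: e_def self_le_power)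
  ultimately have "P dvd w ^ e" using le_imp_power_dvd dvd_trans by blast
  moreover have "w ^ e = monom 1 e * (monom 1 (M * e) - 1)"
  proof -
    \<comment> \<open>Splitting \<open>X ^ M\<close> as a sum avoids the sign of \<open>(-1) ^ e\<close>.\<close>
    have "(monom 1 M - 1 + 1 :: 'r poly) ^ e = (monom 1 M - 1) ^ e + 1 ^ e"
      by (rule freshmans_dream'[of _ "degree P"]) (use char in \<open>auto simp: e_def\<close>)
    then have "(monom 1 M - 1 :: 'r poly) ^ e = monom 1 (M * e) - 1"
      by (simp add: monom_power algebra_simps)
    then show ?thesis by (simp add: w_def power_mult_distrib monom_power)
  qed
  moreover have "M * e > 0" using \<open>M > 0\<close> prime_gt_0_nat[OF char] by (simp add: e_def)
  ultimately show ?thesis by metis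
qed

section \<open>Torsion in general linear groups\<close>

lemma one_pow_mat: "1\<^sub>m n ^\<^sub>m k = (1\<^sub>m n :: 'a::semiring_1 mat)"
  by (induction k) auto

lemma monom_minus_1_neq_0:
  assumes "m > 0"
  shows "monom 1 m - 1 \<noteq> (0 :: 'a::comm_ring_1 poly)"
proof -
  have "coeff (monom 1 m - 1 :: 'a poly) m = 1" using assms by (simp add: coeff_1)
  then show ?thesis by (metis coeff_0 zero_neq_one)
qed

text \<open>The primitive minimal polynomial of a torsion matrix divides some \<open>X ^ m - 1\<close>, whose coefficients
  are constants, so its own coefficients are constants in a finite field. Its degree is
  bounded as well, which leaves finitely many possibilities. All matrices with the same minimal
  polynomial are killed by the same exponents, and the product of one exponent for each
  possibility kills all torsion.\<close>

lemma torsion_exponent_bounded: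
  fixes \<phi> :: "'p::prime_card mod_ring poly fract \<Rightarrow> 'k::field"
  assumes "finite_field_extension \<phi>"
  obtains M where "M > 0"
    and "\<And>(x :: 'k mat) m. x \<in> carrier_mat n n \<Longrightarrow> m > 0 \<Longrightarrow> x ^\<^sub>m m = 1\<^sub>m n \<Longrightarrow> x ^\<^sub>m M = 1\<^sub>m n"
proof -
  define \<psi> where "\<psi> = \<phi> \<circ> to_fract"
  interpret field_hom \<phi> using assms by (simp add: finite_field_extension_def)
  interpret \<psi>: comm_ring_hom \<psi> by unfold_locales (auto simp: \<psi>_def hom_add hom_mult)
  obtain D where D: "\<And>x. x \<in> carrier_mat n n \<Longrightarrow> \<exists>P. P \<noteq> 0 \<and> degree P \<le> D \<and> content P = 1 \<and>
      (\<forall>F. annihilates \<psi> F x \<longleftrightarrow> P dvd F)"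
    using exists_primitive_minimal_polynomial[OF assms] unfolding \<psi>_def by blast
  define S :: "'p mod_ring poly poly set"
    where "S = {P. degree P \<le> D \<and> (\<forall>i. degree (coeff P i) \<le> 0)}"
  define T where "T = {P \<in> S. \<exists>m>0. P dvd monom 1 m - 1}"
  have "finite T"
    unfolding T_def S_def by (rule finite_subset[OF _ finite_poly_polys_bounded[of D 0]]) auto
  have "\<forall>P\<in>T. \<exists>m>0. P dvd monom 1 m - 1" by (simp add: T_def)
  then obtain m where m: "\<And>P. P \<in> T \<Longrightarrow> m P > 0" "\<And>P. P \<in> T \<Longrightarrow> P dvd monom 1 (m P) - 1" by metis
  show thesis
  proof (rule that[of "\<Prod>P\<in>T. m P"])
    show "(\<Prod>P\<in>T. m P) > 0" using m by (intro prod_pos) auto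
    fix x :: "'k mat" and k assume x: "x \<in> carrier_mat n n" "k > 0" "x ^\<^sub>m k = 1\<^sub>m n"
    obtain P where P: "degree P \<le> D" "\<And>F. annihilates \<psi> F x \<longleftrightarrow> P dvd F"
      using D[OF x(1)] by blast
    have dvd: "P dvd monom 1 k - 1"
      using x by (simp add: P(2)[symmetric] \<psi>.annihilates_monom_minus_1)
    have "degree (coeff P i) \<le> 0" for i
      by (rule coeff_degree_le_of_dvd[OF dvd monom_minus_1_neq_0[OF x(2)]]) (simp add: coeff_1)
    then have "P \<in> T" using P(1) dvd x(2) by (auto simp: T_def S_def)
    then have "annihilates \<psi> (monom 1 (m P) - 1) x" using m(2) P(2) by blast
    then have "x ^\<^sub>m m P = 1\<^sub>m n" by (simp add: \<psi>.annihilates_monom_minus_1[OF x(1)])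
    moreover have "m P dvd (\<Prod>P\<in>T. m P)"
      by (rule dvd_prodI) (fact+)
    ultimately show "x ^\<^sub>m (\<Prod>P\<in>T. m P) = 1\<^sub>m n"
      using x(1) by (elim dvdE) (simp add: pow_mat_mult one_pow_mat)
  qed
qed

text \<open>Let \<open>F\<close> annihilate \<open>g\<close>. The primitive minimal polynomial of a root \<open>x\<close> with \<open>x ^ (q ^ k) = g\<close>
  divides \<open>F(X ^ (q ^ k))\<close>, whose nonzero coefficients are those of \<open>F\<close>; so its degree in \<open>t\<close> is bounded
  independently of \<open>k\<close>. By the pigeonhole principle infinitely many \<open>k\<close> share one minimal polynomial
  \<open>P\<close>, to which the lemma on recurring roots applies. An invertible matrix annihilated by
  \<open>X ^ s (X ^ M - 1)\<close> is torsion.\<close>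

lemma torsion_if_prime_power_divisible:
  fixes \<phi> :: "'p::prime_card mod_ring poly fract \<Rightarrow> 'k::field"
    and g :: "'k mat"
  assumes "finite_field_extension \<phi>" and "q \<ge> 2" and g: "g \<in> carrier_mat n n"
    and roots: "\<And>k. k \<ge> 1 \<Longrightarrow> \<exists>x \<in> carrier_mat n n. \<exists>y \<in> carrier_mat n n.
      x * y = 1\<^sub>m n \<and> x ^\<^sub>m (q ^ k) = g"
  shows "\<exists>m>0. g ^\<^sub>m m = 1\<^sub>m n"
proof -
  define \<psi> where "\<psi> = \<phi> \<circ> to_fract"
  interpret field_hom \<phi> using assms by (simp add: finite_field_extension_def)
  interpret \<psi>: comm_ring_hom \<psi> by unfold_locales (auto simp: \<psi>_def hom_add hom_mult)
  obtain D where D: "\<And>x. x \<in> carrier_mat n n \<Longrightarrow> \<exists>P. P \<noteq> 0 \<and> degree P \<le> D \<and> content P = 1 \<and>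
      (\<forall>F. annihilates \<psi> F x \<longleftrightarrow> P dvd F)"
    using exists_primitive_minimal_polynomial[OF assms(1)] unfolding \<psi>_def by blast
  obtain F where F: "F \<noteq> 0" "annihilates \<psi> F g" using D[OF g] by auto
  define C where "C = Max ((\<lambda>i. degree (coeff F i)) ` {..degree F})"
  have C: "degree (coeff F i) \<le> C" for i
    by (cases "i \<le> degree F") (auto simp: C_def coeff_eq_0 not_le)
  define root_with_annihilator where "root_with_annihilator k P \<longleftrightarrow> degree P \<le> D \<and> content P = 1 \<and>
      (\<exists>x \<in> carrier_mat n n. \<exists>y \<in> carrier_mat n n. x * y = 1\<^sub>m n \<and> x ^\<^sub>m (q ^ k) = g \<and>
        (\<forall>F. annihilates \<psi> F x \<longleftrightarrow> P dvd F))" for k P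
  have "\<exists>P. root_with_annihilator k P" if k: "k \<ge> 1" for k
  proof -
    obtain x y where x: "x \<in> carrier_mat n n" "y \<in> carrier_mat n n" "x * y = 1\<^sub>m n"
      "x ^\<^sub>m (q ^ k) = g" using roots[OF k] by blast
    obtain P where "degree P \<le> D" "content P = 1" "\<forall>F. annihilates \<psi> F x \<longleftrightarrow> P dvd F"
      using D[OF x(1)] by blast
    with x have "root_with_annihilator k P"
      unfolding root_with_annihilator_def by (intro conjI bexI[of _ x] bexI[of _ y])
    then show ?thesis ..
  qed
  then obtain P where P: "\<And>k. k \<ge> 1 \<Longrightarrow> root_with_annihilator k (P k)" by metis
  have dvd: "P k dvd F \<circ>\<^sub>p monom 1 (q ^ k)" if "k \<ge> 1" for k
    using P[OF that] F(2) unfolding root_with_annihilator_def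
    by (metis \<psi>.annihilates_pcompose_monom)
  have "degree (coeff (P k) i) \<le> C" if "k \<ge> 1" for k i
  proof (rule coeff_degree_le_of_dvd[OF dvd[OF that]])
    show "F \<circ>\<^sub>p monom 1 (q ^ k) \<noteq> 0"
      using F(1) \<open>q \<ge> 2\<close> by (subst pcompose_eq_0_iff) (auto simp: degree_monom_eq)
  qed (rule degree_coeff_pcompose_monom_le[OF C])
  then have "P ` {1..} \<subseteq> {P. degree P \<le> D \<and> (\<forall>i. degree (coeff P i) \<le> C)}"
    using P by (auto simp: root_with_annihilator_def)
  then have "finite (P ` {1..})" using finite_poly_polys_bounded by (rule finite_subset)
  then obtain k0 where k0: "k0 \<ge> 1" and inf: "infinite {k \<in> {1..}. P k = P k0}"
    using pigeonhole_infinite[of "{1..}" P] infinite_Ici by auto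
  obtain x y where x: "x \<in> carrier_mat n n" "x ^\<^sub>m (q ^ k0) = g"
    and y: "y \<in> carrier_mat n n" "x * y = 1\<^sub>m n"
    and content: "content (P k0) = 1" and P0: "\<And>F. annihilates \<psi> F x \<longleftrightarrow> P k0 dvd F"
    using P[OF k0] by (auto simp: root_with_annihilator_def)
  have "\<exists>s M. M > 0 \<and> P k0 dvd monom 1 s * (monom 1 M - 1)"
  proof (rule dvd_monom_times_unity_if_roots_recur[OF _ content F(1) \<open>q \<ge> 2\<close> inf])
    show "prime CHAR('p mod_ring poly)" by (simp add: prime_card)
    show "P k0 dvd F \<circ>\<^sub>p monom 1 (q ^ l)" if "l \<in> {k \<in> {1..}. P k = P k0}" for l
      using dvd[of l] that by simp
  qed
  then obtain s M where M: "M > 0" "annihilates \<psi> (monom 1 s * (monom 1 M - 1)) x"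
    using P0 by blast
  have "annihilates \<psi> (monom 1 M - 1) x"
    by (rule \<psi>.annihilates_monom_mult_cancel[OF x(1) y M(2)])
  then have 1: "x ^\<^sub>m M = 1\<^sub>m n" by (simp add: \<psi>.annihilates_monom_minus_1[OF x(1)])
  have "g ^\<^sub>m M = x ^\<^sub>m (M * q ^ k0)"
    using x by (simp add: pow_mat_mult[OF x(1), symmetric] mult.commute flip: x(2))
  also have "\<dots> = 1\<^sub>m n" using x(1) by (simp add: pow_mat_mult 1 one_pow_mat)
  finally show ?thesis using M(1) by blast
qed

section \<open>Divisible elements of linear algebraic groups\<close>

lemma GL_carrierE:
  fixes x :: "'a::field mat"
  assumes "x \<in> carrier (GL n)"
  obtains y where "x \<in> carrier_mat n n" "y \<in> carrier_mat n n" "x * y = 1\<^sub>m n"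
proof -
  from assms have "x \<in> Units (ring_mat TYPE('a) n ())" by (simp add: GL_def units_of_def)
  then obtain y where "x \<in> carrier_mat n n" "y \<in> carrier_mat n n" "x * y = 1\<^sub>m n"
    unfolding Units_def ring_mat_simps by blast
  then show thesis by (rule that)
qed

lemma GL_one: "\<one>\<^bsub>GL n\<^esub> = 1\<^sub>m n"
  by (simp add: GL_def units_of_def ring_mat_simps)

lemma GL_pow:
  fixes x :: "'a::field mat"
  assumes "x \<in> carrier (GL n)"
  shows "x [^]\<^bsub>GL n\<^esub> k = x ^\<^sub>m k"
proof -
  interpret ring "ring_mat TYPE('a) n ()" by (rule ring_mat)
  have "x \<in> Units (ring_mat TYPE('a) n ())" using assms by (simp add: GL_def units_of_def)
  moreover have "x \<in> carrier_mat n n" using assms by (rule GL_carrierE)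
  ultimately show ?thesis by (simp add: GL_def units_of_pow pow_mat_ring_pow[of _ n _ "()"])
qed

text \<open>Write \<open>M = q ^ v * N\<close> with \<open>q\<close> not dividing \<open>N\<close>. As \<open>g\<close> is the power of some \<open>x\<close> with exponent
  divisible by \<open>q ^ v\<close>, already \<open>g ^ N\<close> is a power of \<open>x ^ M = 1\<close>.\<close>

lemma (in group) ord_coprime_if_divisible:
  fixes M q :: nat
  assumes "prime q" and g: "g \<in> carrier G" and "M > 0"
    and roots: "\<And>k. k \<ge> 1 \<Longrightarrow> \<exists>x \<in> carrier G. x [^] (q ^ k) = g \<and> x [^] M = \<one>"
  shows "coprime (ord g) q"
proof -
  obtain N where "M = q ^ multiplicity q M * N" and q_ndvd_N: "\<not> q dvd N"
    by (rule multiplicity_decompose'[of M q])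
      (use \<open>prime q\<close> \<open>M > 0\<close> not_prime_unit[of q] in auto)
  then obtain v where N: "M = q ^ v * N" by blast
  obtain x where x: "x \<in> carrier G" "x [^] (q ^ Suc v) = g" "x [^] M = \<one>"
    using roots[of "Suc v"] by auto
  have "g [^] N = x [^] (q ^ Suc v * N)"
    using x(1) by (simp only: x(2)[symmetric] nat_pow_pow)
  also have "q ^ Suc v * N = M * q" by (simp add: N)
  also have "x [^] (M * q) = \<one>" using x by (simp add: nat_pow_pow[symmetric])
  finally have "ord g dvd N" using g by (simp add: pow_eq_id)
  moreover have "coprime N q"
    using q_ndvd_N \<open>prime q\<close> prime_imp_coprime[of q N] by (simp add: coprime_commute)
  ultimately show ?thesis using coprime_divisors[OF _ dvd_refl, of "ord g" N q] by blast
qed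

lemma (in group) pow_root_if_coprime_ord:
  assumes g: "g \<in> carrier G" and "coprime (ord g) m" "m > 0"
  shows "\<exists>j::nat. (g [^] j) [^] m = g"
proof -
  from bezout_nat[of m "ord g"] \<open>m > 0\<close> obtain j t where jt: "m * j = ord g * t + gcd m (ord g)" by auto
  have "gcd m (ord g) = 1" using assms(2) by (simp add: coprime_iff_gcd_eq_1 gcd.commute)
  with jt have "j * m = ord g * t + 1" by (simp add: mult.commute)
  then have "(g [^] j) [^] m = g [^] (ord g * t) \<otimes> g"
    using g by (simp add: nat_pow_pow)
  also have "g [^] (ord g * t) = \<one>"
    using g by (simp only: nat_pow_pow[symmetric] pow_ord_eq_1 nat_pow_one)
  also have "\<one> \<otimes> g = g" using g by simp
  finally show ?thesis ..
qed

lemma pow_in_rational_points_zariski_closure: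
  fixes g :: "'k::field mat"
  assumes "g \<in> carrier (GL n)" "map_mat to_ac g \<in> carrier (GL n)"
  shows "g [^]\<^bsub>GL n\<^esub> (j::nat) \<in>
    rational_points n (zariski_closure n (generate (GL n) {map_mat to_ac g}))"
proof -
  interpret K: group "GL n :: 'k mat monoid" by (rule group_GL)
  interpret A: group "GL n :: 'k alg_closure mat monoid" by (rule group_GL)
  interpret to_ac: semiring_hom "to_ac :: 'k \<Rightarrow> 'k alg_closure" by unfold_locales auto
  have "g \<in> carrier_mat n n" using assms(1) by (rule GL_carrierE)
  then have "map_mat to_ac (g [^]\<^bsub>GL n\<^esub> j) = map_mat to_ac g [^]\<^bsub>GL n\<^esub> j"
    using assms by (simp add: GL_pow to_ac.mat_hom_pow)
  also have "\<dots> = map_mat to_ac g [^]\<^bsub>GL n\<^esub> int j" by (simp add: int_pow_int)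
  also have "\<dots> \<in> generate (GL n) {map_mat to_ac g}" using A.generate_pow[OF assms(2)] by blast
  also have "\<dots> \<subseteq> zariski_closure n (generate (GL n) {map_mat to_ac g})"
    by (auto simp: zariski_closure_def)
  finally show ?thesis using assms(1) by (simp add: rational_points_def)
qed

theorem corollary4p4:
  fixes G H :: "'k::field alg_closure mat set"
    and g :: "'k mat"
    and n q :: nat
  assumes "global_field_of_char TYPE('p::prime_card) TYPE('k)"
    and "linear_algebraic_group n G"
    and "g \<in> rational_points n G"
    and "prime q"
    and "\<forall>k\<ge>1. \<exists>x \<in> rational_points n G. x [^]\<^bsub>GL n\<^esub> (q ^ k) = g"
    and "H = zariski_closure n (generate (GL n) {map_mat to_ac g})"
  shows "(\<forall>k\<ge>1. \<exists>y \<in> rational_points n H. y [^]\<^bsub>GL n\<^esub> (q ^ k) = g) \<and>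
    (group.ord (GL n) g \<noteq> 0 \<longrightarrow> coprime (group.ord (GL n) g) q) \<and>
    ((\<forall>k::nat. k \<ge> 1 \<longrightarrow> (\<exists>h \<in> rational_points n G. h [^]\<^bsub>GL n\<^esub> k = g)) \<longrightarrow>
      g = \<one>\<^bsub>GL n\<^esub>)"
proof -
  interpret K: group "GL n :: 'k mat monoid" by (rule group_GL)
  from assms(1) obtain \<phi> :: "'p mod_ring poly fract \<Rightarrow> 'k" where \<phi>: "finite_field_extension \<phi>"
    by (auto simp: global_field_of_char_def)
  have rat: "x \<in> carrier (GL n)" if "x \<in> rational_points n G" for x
    using that by (simp add: rational_points_def)
  have g: "g \<in> carrier (GL n)" using assms(3) rat by blast
  have g': "map_mat to_ac g \<in> carrier (GL n)"
    using assms(2,3) by (auto simp: rational_points_def linear_algebraic_group_def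
        dest: subgroup.mem_carrier)
  have "q \<ge> 2" using assms(4) by (rule prime_ge_2_nat)
  obtain M where "M > 0" and M: "\<And>x m. x \<in> carrier_mat n n \<Longrightarrow> m > 0 \<Longrightarrow>
      x ^\<^sub>m m = 1\<^sub>m n \<Longrightarrow> x ^\<^sub>m M = (1\<^sub>m n :: 'k mat)"
    using torsion_exponent_bounded[OF \<phi>] by blast
  have "\<exists>m>0. g ^\<^sub>m m = 1\<^sub>m n"
  proof (rule torsion_if_prime_power_divisible[OF \<phi> \<open>q \<ge> 2\<close>])
    show "g \<in> carrier_mat n n" using g by (rule GL_carrierE)
    fix k :: nat assume "k \<ge> 1"
    then obtain x where x: "x \<in> carrier (GL n)" "x [^]\<^bsub>GL n\<^esub> (q ^ k) = g" using assms(5) rat by blast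
    from x(1) obtain y where "x \<in> carrier_mat n n" "y \<in> carrier_mat n n" "x * y = 1\<^sub>m n"
      by (rule GL_carrierE)
    with x show "\<exists>x\<in>carrier_mat n n. \<exists>y\<in>carrier_mat n n. x * y = 1\<^sub>m n \<and> x ^\<^sub>m (q ^ k) = g"
      by (auto simp: GL_pow)
  qed
  then obtain m :: nat where m: "m > 0" "g [^]\<^bsub>GL n\<^esub> m = \<one>\<^bsub>GL n\<^esub>" using g by (auto simp: GL_pow GL_one)
  \<comment> \<open>Every root of \<open>g\<close> is torsion because \<open>g\<close> is, so the uniform exponent kills it.\<close>
  have root: "x [^]\<^bsub>GL n\<^esub> M = \<one>\<^bsub>GL n\<^esub>"
    if x: "x \<in> carrier (GL n)" "x [^]\<^bsub>GL n\<^esub> k = g" and "k > 0" for x :: "'k mat" and k :: nat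
  proof -
    have "x [^]\<^bsub>GL n\<^esub> (k * m) = \<one>\<^bsub>GL n\<^esub>" using x m by (simp add: K.nat_pow_pow[symmetric])
    moreover have "x \<in> carrier_mat n n" using x(1) by (rule GL_carrierE)
    ultimately show ?thesis using M[of x "k * m"] x \<open>k > 0\<close> m(1) by (simp add: GL_pow GL_one)
  qed
  have coprime: "coprime (K.ord g) q"
  proof (rule K.ord_coprime_if_divisible[OF assms(4) g \<open>M > 0\<close>])
    fix k :: nat assume "k \<ge> 1"
    then obtain x where "x \<in> carrier (GL n)" "x [^]\<^bsub>GL n\<^esub> (q ^ k) = g" using assms(5) rat by blast
    then show "\<exists>x\<in>carrier (GL n). x [^]\<^bsub>GL n\<^esub> (q ^ k) = g \<and> x [^]\<^bsub>GL n\<^esub> M = \<one>\<^bsub>GL n\<^esub>"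
      using root[of x "q ^ k"] \<open>q \<ge> 2\<close> by auto
  qed
  have "\<exists>y \<in> rational_points n H. y [^]\<^bsub>GL n\<^esub> (q ^ k) = g" for k
  proof -
    obtain j :: nat where "(g [^]\<^bsub>GL n\<^esub> j) [^]\<^bsub>GL n\<^esub> (q ^ k) = g"
      using K.pow_root_if_coprime_ord[OF g, of "q ^ k"] coprime \<open>q \<ge> 2\<close> by auto
    then show ?thesis
      using pow_in_rational_points_zariski_closure[OF g g'] assms(6) by blast
  qed
  moreover have "g = \<one>\<^bsub>GL n\<^esub>"
    if "\<forall>k::nat. k \<ge> 1 \<longrightarrow> (\<exists>h \<in> rational_points n G. h [^]\<^bsub>GL n\<^esub> k = g)"
  proof -
    have "M \<ge> 1" using \<open>M > 0\<close> by simp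
    with that rat obtain h where "h \<in> carrier (GL n)" "h [^]\<^bsub>GL n\<^esub> M = g" by blast
    with root[of h M] \<open>M > 0\<close> show ?thesis by simp
  qed
  ultimately show ?thesis using coprime by blast
qed

end
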